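(* Let $n\ge 2$, $a\in(0,1)$, and $p(z)=(z-a)\prod_{k=1}^{n-1}(z-z_k)$ with $|z_k|\le 1$ for all $k$. Write $p'(z)=n\prod_{j=1}^{n-1}(z-\zeta_j)$ and $\rho_1=\min_{1\le j\le n-1}|a-\zeta_j|$. Suppose $\lambda$ is a real number with $$1-(1-|p(0)|)^{1/n}\le \lambda\le \sin(\pi/n),\qquad \lambda<a,$$ and suppose $\rho_1\ge 1$. Then there exists a critical point $\zeta_0$ of $p$ (i.e. $p'(\zeta_0)=0$) such that $$\operatorname{Re}\zeta_0\ \ge\ \frac12\Big(a-\frac{\lambda(\lambda+2)}{a}\Big).$$
   Context: The zeros $\zeta_1,\dots,\zeta_{n-1}$ of $p'$ (the critical points of $p$) are listed with multiplicity. *)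

theory Defs
  imports "HOL-Analysis.Analysis" "HOL-Computational_Algebra.Polynomial"
begin

end

theory Submission
  imports Defs "HOL-Complex_Analysis.Conformal_Mappings"
    "HOL-Computational_Algebra.Fundamental_Theorem_Algebra"
begin

text \<open>For \<open>\<bar>z\<bar> = \<lambda>\<close>, the increment of \<open>p\<close> from \<open>a\<close> to \<open>a + z\<close> is \<open>p'(a)\<close> times the integral of
  \<open>\<Prod>(1 - t u\<^sub>j)\<close> over \<open>[0, z]\<close>, with \<open>u\<^sub>j = 1 / (\<zeta>\<^sub>j - a)\<close> in the unit disc and \<open>\<bar>p'(a)\<bar> \<ge> n\<close>. By the
  coincidence theorem of Grace and Walsh all \<open>u\<^sub>j\<close> may be taken equal, whence
  \<open>\<bar>p(a + z)\<bar> \<ge> 1 - (1 - \<lambda>)\<^sup>n \<ge> \<bar>p(0)\<bar>\<close>; this uses \<open>\<lambda> \<le> sin(\<pi>/n)\<close>, which keeps \<open>1 - z u\<close> in the sector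
  where the principal \<open>n\<close>-th root inverts the \<open>n\<close>-th power. As \<open>p\<close> is open, it takes the value \<open>p(0)\<close> at some
  \<open>c\<close> with \<open>\<bar>c - a\<bar> \<le> \<lambda>\<close>. Coincidence on the half-plane \<open>\<bar>x\<bar> < \<bar>x - c\<bar>\<close> then gives a critical point \<open>\<zeta>\<^sub>0\<close>
  with \<open>\<bar>\<zeta>\<^sub>0 - c\<bar> \<le> \<bar>\<zeta>\<^sub>0\<bar>\<close>, so \<open>\<bar>\<zeta>\<^sub>0 - a\<bar> \<le> \<bar>\<zeta>\<^sub>0\<bar> + \<lambda>\<close>, and squaring with \<open>\<bar>\<zeta>\<^sub>0\<bar> \<le> 1\<close> (Gauss--Lucas) gives
  the bound.\<close>

section \<open>Logarithmic derivative and the Gauss-Lucas theorem for a disc\<close>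

lemma pderiv_root_product_quotient:
  fixes x :: "'a::field"
  assumes "x \<notin># A"
  shows "poly (pderiv (\<Prod>r\<in>#A. [:- r, 1:])) x
       = poly (\<Prod>r\<in>#A. [:- r, 1:]) x * (\<Sum>r\<in>#A. 1 / (x - r))"
  using assms
proof (induction A)
  case (add a A)
  let ?P = "\<Prod>r\<in>#A. [:- r, 1:]"
  have "pderiv ([:- a, 1:] * ?P) = [:- a, 1:] * pderiv ?P + ?P"
    by (subst pderiv_mult) (simp add: pderiv_pCons)
  moreover have "x \<noteq> a" using add.prems by auto
  ultimately show ?case using add by (simp del: mult_pCons_left add: field_simps)
qed simp

text \<open>If \<open>cmod x > R\<close>, every term \<open>x / (x - r)\<close> has positive real
  part, so the logarithmic derivative cannot vanish at \<open>x\<close>.\<close>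

lemma gauss_lucas_disc:
  assumes "Z \<noteq> {#}" and Z: "\<And>r. r \<in># Z \<Longrightarrow> cmod r \<le> R"
    and x: "poly (pderiv (\<Prod>r\<in>#Z. [:- r, 1:])) x = 0"
  shows "cmod x \<le> R"
proof (rule ccontr)
  assume out: "\<not> cmod x \<le> R"
  have pos: "0 < Re (x * (1 / (x - r)))" if "cmod r \<le> R" for r
  proof -
    have "cmod r < cmod x" using out that by linarith
    then have "x \<noteq> r" and "x \<noteq> 0" by auto
    have "Re (x * cnj r) \<le> cmod x * cmod r"
      using complex_Re_le_cmod[of "x * cnj r"] by (simp add: norm_mult)
    also have "\<dots> < cmod x * cmod x" using \<open>cmod r < cmod x\<close> \<open>x \<noteq> 0\<close> by simp
    also have "\<dots> = Re (x * cnj x)" using cmod_power2[of x] by (simp add: power2_eq_square)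
    finally have "0 < Re (x * cnj (x - r))" by (simp add: algebra_simps)
    moreover have "x * (1 / (x - r)) = x * cnj (x - r) / of_real ((cmod (x - r))\<^sup>2)"
      using complex_div_cnj[of x "x - r"] by simp
    ultimately show ?thesis using \<open>x \<noteq> r\<close>
      by (simp only: Re_divide_of_real) simp
  qed
  have "x \<notin># Z" using Z out by auto
  moreover from this have "poly (\<Prod>r\<in>#Z. [:- r, 1:]) x \<noteq> 0" by (auto simp: poly_prod_mset)
  ultimately have "(\<Sum>r\<in>#Z. 1 / (x - r)) = 0"
    using pderiv_root_product_quotient[of x Z] x by simp
  \<comment> \<open>The disjunct \<open>Z = {#}\<close> starts the induction, where the sum is
    0.\<close>
  moreover have "0 < Re (x * (\<Sum>r\<in>#Z. 1 / (x - r))) \<or> Z = {#}"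
    using Z
  proof (induction Z)
    case (add r Z)
    have "0 < Re (x * (1 / (x - r)))" using add.prems by (intro pos) auto
    moreover have "0 < Re (x * (\<Sum>r\<in>#Z. 1 / (x - r))) \<or> Z = {#}" using add by auto
    ultimately show ?case by (auto simp: distrib_left simp del: times_complex.sel)
  qed simp
  ultimately show False using assms(1) by simp
qed

section \<open>Laguerre's theorem and Grace-Walsh coincidence\<close>

text \<open>The sum is \<open>N\<close> times the mean of the values padded with zeros up to
  \<open>N\<close> terms. In Laguerre's theorem the zeros stand for roots at infinity of a
  polynomial of degree below \<open>N\<close>.\<close>

lemma convex_sum_mset:
  fixes K :: "'b::real_vector set"
  assumes "convex K" "\<And>r. r \<in># A \<Longrightarrow> f r \<in> K" "0 \<in> K" "size A \<le> N"
  shows "\<exists>k\<in>K. (\<Sum>r\<in>#A. f r) = real N *\<^sub>R k"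
proof -
  have "\<exists>k\<in>K. (\<Sum>r\<in>#A. f r) = real (size A) *\<^sub>R k"
    using assms(2)
  proof (induction A)
    case empty
    then show ?case using assms(3) by auto
  next
    case (add r A)
    then obtain k where k: "k \<in> K" "(\<Sum>r\<in>#A. f r) = real (size A) *\<^sub>R k" by auto
    let ?s = "real (size A)"
    have "(?s / (?s + 1)) *\<^sub>R k + (1 / (?s + 1)) *\<^sub>R f r \<in> K"
      using add.prems k(1) assms(1) by (intro convexD) (auto simp: field_simps)
    moreover have "(?s + 1) *\<^sub>R ((?s / (?s + 1)) *\<^sub>R k + (1 / (?s + 1)) *\<^sub>R f r) = ?s *\<^sub>R k + f r"
      by (simp add: scaleR_add_right)
    ultimately show ?case using k(2) by (intro bexI) (auto simp: algebra_simps)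
  qed
  then obtain k where k: "k \<in> K" "(\<Sum>r\<in>#A. f r) = real (size A) *\<^sub>R k" by auto
  show ?thesis
  proof (cases "N = 0")
    case True
    then show ?thesis using assms by auto
  next
    case False
    have "(real (size A) / real N) *\<^sub>R k + (1 - real (size A) / real N) *\<^sub>R 0 \<in> K"
      using False assms k(1) by (intro convexD) (auto simp: field_simps)
    then show ?thesis using k(2) False
      by (intro bexI[of _ "(real (size A) / real N) *\<^sub>R k"]) auto
  qed
qed

text \<open>The convexity hypothesis says that \<open>r \<mapsto> 1 / (x - r)\<close> maps the complement of \<open>C\<close> in the Riemann sphere
  (\<open>\<infinity>\<close> going to \<open>0\<close>) onto a convex set, which is what makes a disc or half-plane \<open>C\<close> admissible.
  If the polar derivative vanished at \<open>x\<close>, then \<open>1 / (x - \<xi>)\<close> would be a mean of points of this set, that is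
  \<open>\<xi> \<notin> C\<close>. The disjunct \<open>y = 0\<close> is needed because \<open>1 / 0 = 0\<close>.\<close>
lemma laguerre_polar_derivative:
  fixes f :: "complex poly"
  assumes conv: "convex {y. y = 0 \<or> x - 1 / y \<notin> C}"
    and nz: "\<And>r. r \<in> C \<Longrightarrow> poly f r \<noteq> 0"
    and deg: "degree f \<le> N" and N: "N > 0" and C: "x \<in> C" "\<xi> \<in> C"
  shows "of_nat N * poly f x + (\<xi> - x) * poly (pderiv f) x \<noteq> 0"
proof
  assume eq: "of_nat N * poly f x + (\<xi> - x) * poly (pderiv f) x = 0"
  have fx: "poly f x \<noteq> 0" and "f \<noteq> 0" using nz C by auto
  obtain A c where A: "size A = degree f" "f = smult c (\<Prod>r\<in>#A. [:- r, 1:])"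
    using alg_closed_imp_factorization[OF \<open>f \<noteq> 0\<close>] by metis
  have roots: "poly f r = 0" if "r \<in># A" for r
  proof -
    have "poly (\<Prod>r\<in>#A. [:- r, 1:]) r = 0" using that by (auto simp: poly_prod_mset)
    then show ?thesis unfolding A(2) by simp
  qed
  then have out: "r \<notin> C" if "r \<in># A" for r using nz that by blast
  have "poly (pderiv f) x = poly f x * (\<Sum>r\<in>#A. 1 / (x - r))"
    using pderiv_root_product_quotient[of x A] out C
    unfolding A(2) by (auto simp: pderiv_smult)
  moreover obtain k where k: "k = 0 \<or> x - 1 / k \<notin> C" "(\<Sum>r\<in>#A. 1 / (x - r)) = real N *\<^sub>R k"
    using convex_sum_mset[OF conv, of A "\<lambda>r. 1 / (x - r)" N] out A(1) deg by auto
  ultimately have "of_nat N * poly f x * (1 + (\<xi> - x) * k) = 0"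
    using eq by (simp add: scaleR_conv_of_real algebra_simps)
  then have "1 + (\<xi> - x) * k = 0" using N fx by simp
  moreover from this have "k \<noteq> 0" by auto
  ultimately have "k \<noteq> 0" "\<xi> = x - 1 / k" by (simp_all add: field_simps)
  then show False using k C by auto
qed

text \<open>Peeling off one factor \<open>A - smult x B\<close> reduces \<open>N\<close> by one and
  replaces \<open>L\<close> by the functionals sending \<open>f\<close> to \<open>L (A * f)\<close>
  and to \<open>L (B * f)\<close>. The derivative formula is what brings in the polar derivative
  later.\<close>

lemma linear_functional_power_poly:
  fixes L :: "complex poly \<Rightarrow> complex" and A B :: "complex poly"
  assumes "\<And>f g. L (f + g) = L f + L g" and "\<And>c f. L (smult c f) = c * L f"
  shows "\<exists>\<Phi>. degree \<Phi> \<le> N \<and> (\<forall>x. poly \<Phi> x = L ((A - smult x B) ^ N) \<and>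
           poly (pderiv \<Phi>) x = - of_nat N * L (B * (A - smult x B) ^ (N - 1)))"
  using assms
proof (induction N arbitrary: L)
  case 0
  show ?case by (rule exI[of _ "[:L 1:]"]) simp
next
  case (Suc N)
  have min: "L (f - g) = L f - L g" for f g
    using Suc.prems(1)[of f "smult (-1) g"] Suc.prems(2)[of "-1" g] by simp
  obtain \<Phi>1 where 1: "degree \<Phi>1 \<le> N" "\<And>x. poly \<Phi>1 x = L (A * (A - smult x B) ^ N)"
       "\<And>x. poly (pderiv \<Phi>1) x = - of_nat N * L (A * (B * (A - smult x B) ^ (N - 1)))"
    using Suc.IH[of "\<lambda>f. L (A * f)"] by (auto simp: Suc.prems distrib_left)
  obtain \<Phi>2 where 2: "degree \<Phi>2 \<le> N" "\<And>x. poly \<Phi>2 x = L (B * (A - smult x B) ^ N)"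
       "\<And>x. poly (pderiv \<Phi>2) x = - of_nat N * L (B * (B * (A - smult x B) ^ (N - 1)))"
    using Suc.IH[of "\<lambda>f. L (B * f)"] by (auto simp: Suc.prems distrib_left)
  have step: "L ((A - smult x B) * f) = L (A * f) - x * L (B * f)" for x f
    by (simp add: left_diff_distrib min Suc.prems)
  \<comment> \<open>\<open>pCons 0 \<Phi>2\<close> is \<open>\<Phi>2\<close> multiplied by the
    variable.\<close>
  have "poly (\<Phi>1 - pCons 0 \<Phi>2) x = L ((A - smult x B) ^ Suc N)" for x
    using step by (simp add: 1 2)
  moreover have "poly (pderiv (\<Phi>1 - pCons 0 \<Phi>2)) x = - of_nat (Suc N) * L (B * (A - smult x B) ^ N)" for x
  proof (cases N)
    case 0
    then show ?thesis using 1 2 by (simp add: pderiv_diff pderiv_pCons)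
  next
    case (Suc M)
    have "L (B * (A - smult x B) ^ N) = L ((A - smult x B) * (B * (A - smult x B) ^ M))"
      using Suc by (simp add: ac_simps)
    also have "\<dots> = L (A * (B * (A - smult x B) ^ M)) - x * L (B * (B * (A - smult x B) ^ M))"
      by (rule step)
    moreover have "- of_nat (Suc M) * P - ((P - x * Q) + x * (- of_nat (Suc M) * Q))
        = - of_nat (Suc (Suc M)) * (P - x * Q)" for P Q :: complex
      by (simp add: algebra_simps)
    ultimately show ?thesis using 1(3)[of x] 2(2,3)[of x]
      unfolding Suc pderiv_diff pderiv_pCons poly_diff poly_add poly_pCons
      by (simp del: of_nat_Suc)
  qed
  moreover have "degree (\<Phi>1 - pCons 0 \<Phi>2) \<le> Suc N"
    using 1(1) 2(1) by (intro degree_diff_le) (auto simp: degree_pCons_le[THEN order_trans])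
  ultimately show ?case by (intro exI[of _ "\<Phi>1 - pCons 0 \<Phi>2"]) simp
qed

text \<open>The common parameter \<open>x\<close> is replaced by the \<open>u j\<close> one at a
  time. Each replacement takes a polar derivative, which stays nonzero on \<open>C\<close> by
  Laguerre; the factor already fixed is then absorbed into \<open>L\<close>.\<close>

theorem grace_coincidence:
  fixes L :: "complex poly \<Rightarrow> complex" and A B :: "complex poly"
  assumes conv: "\<And>x. x \<in> C \<Longrightarrow> convex {y. y = 0 \<or> x - 1 / y \<notin> C}"
    and "C \<noteq> {}" and "finite I" and "\<And>j. j \<in> I \<Longrightarrow> u j \<in> C"
    and "\<And>f g. L (f + g) = L f + L g" and "\<And>c f. L (smult c f) = c * L f"
    and "\<And>x. x \<in> C \<Longrightarrow> L ((A - smult x B) ^ card I) \<noteq> 0"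
  shows "L (\<Prod>j\<in>I. A - smult (u j) B) \<noteq> 0"
  using assms(3-)
proof (induction I arbitrary: L rule: finite_induct)
  case empty
  then show ?case using assms(2) by auto
next
  case (insert i I)
  let ?N = "Suc (card I)"
  obtain \<Phi> where \<Phi>: "degree \<Phi> \<le> ?N" "\<And>x. poly \<Phi> x = L ((A - smult x B) ^ ?N)"
      "\<And>x. poly (pderiv \<Phi>) x = - of_nat ?N * L (B * (A - smult x B) ^ card I)"
    using linear_functional_power_poly[of L ?N A B] insert.prems by auto
  have "L ((A - smult (u i) B) * (A - smult x B) ^ card I) \<noteq> 0" if x: "x \<in> C" for x
  proof -
    have "(A - smult (u i) B) * (A - smult x B) ^ card I
       = (A - smult x B) ^ ?N + smult (x - u i) (B * (A - smult x B) ^ card I)"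
      by (simp add: algebra_simps smult_diff_left)
    then have "L ((A - smult (u i) B) * (A - smult x B) ^ card I)
       = poly \<Phi> x + (x - u i) * L (B * (A - smult x B) ^ card I)"
      by (simp only: \<Phi>(2) insert.prems)
    \<comment> \<open>The right-hand side is the polar derivative of \<open>\<Phi>\<close> at
      \<open>x\<close> with pole \<open>u i\<close>.\<close>
    then have "of_nat ?N * L ((A - smult (u i) B) * (A - smult x B) ^ card I)
        = of_nat ?N * poly \<Phi> x + (u i - x) * poly (pderiv \<Phi>) x"
      unfolding \<Phi>(3) by (simp only: ring_distribs minus_mult_left[symmetric] minus_mult_right[symmetric] mult.left_commute) simp
    also have "\<dots> \<noteq> 0"
      using laguerre_polar_derivative[OF conv[OF x], of \<Phi> ?N "u i"] \<Phi> insert.prems insert.hyps x by (simp del: of_nat_Suc)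
    finally show ?thesis by auto
  qed
  then have "L ((A - smult (u i) B) * (\<Prod>j\<in>I. A - smult (u j) B)) \<noteq> 0"
    using insert.prems(1)
    by (intro insert.IH[of "\<lambda>f. L ((A - smult (u i) B) * f)"])
       (simp_all only: insert_iff simp_thms distrib_left mult_smult_right insert.prems)
  then show ?case unfolding prod.insert[OF insert.hyps] .
qed

section \<open>Convexity of inverted complements of a disc and a half-plane\<close>

lemma convex_quadratic_sublevel:
  fixes b :: complex
  assumes "\<alpha> \<ge> 0"
  shows "convex {y. \<alpha> * (cmod y)\<^sup>2 + Re (b * y) \<le> \<gamma>}" (is ?le)
    and "convex {y. \<alpha> * (cmod y)\<^sup>2 + Re (b * y) < \<gamma>}" (is ?lt)
proof -
  have "convex_on UNIV (\<lambda>y. \<alpha> * (cmod y)\<^sup>2 + Re (b * y))"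
  proof (rule convex_onI)
    fix t :: real and y z :: complex
    assume t: "0 < t" "t < 1"
    have "(cmod ((1 - t) *\<^sub>R y + t *\<^sub>R z))\<^sup>2 
       = (1 - t) * (cmod y)\<^sup>2 + t * (cmod z)\<^sup>2 - t * (1 - t) * (cmod (y - z))\<^sup>2"
      unfolding cmod_power2 by (simp add: power2_eq_square algebra_simps)
    also have "\<dots> \<le> (1 - t) * (cmod y)\<^sup>2 + t * (cmod z)\<^sup>2" using t by simp
    finally have "\<alpha> * (cmod ((1 - t) *\<^sub>R y + t *\<^sub>R z))\<^sup>2 \<le> \<alpha> * ((1 - t) * (cmod y)\<^sup>2 + t * (cmod z)\<^sup>2)"
      using assms by (rule mult_left_mono)
    then show "\<alpha> * (cmod ((1 - t) *\<^sub>R y + t *\<^sub>R z))\<^sup>2 + Re (b * ((1 - t) *\<^sub>R y + t *\<^sub>R z))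
      \<le> (1 - t) * (\<alpha> * (cmod y)\<^sup>2 + Re (b * y)) + t * (\<alpha> * (cmod z)\<^sup>2 + Re (b * z))"
      by (simp add: algebra_simps)
  qed simp
  then have cv: "\<alpha> * (cmod (u *\<^sub>R x + v *\<^sub>R y))\<^sup>2 + Re (b * (u *\<^sub>R x + v *\<^sub>R y))
      \<le> u * (\<alpha> * (cmod x)\<^sup>2 + Re (b * x)) + v * (\<alpha> * (cmod y)\<^sup>2 + Re (b * y))"
    if "0 \<le> u" "0 \<le> v" "u + v = 1" for u v x y
    using that unfolding convex_on_def by blast
  show ?le
  proof (rule convexI)
    fix x y and u v :: real
    assume "x \<in> {y. \<alpha> * (cmod y)\<^sup>2 + Re (b * y) \<le> \<gamma>}"
      "y \<in> {y. \<alpha> * (cmod y)\<^sup>2 + Re (b * y) \<le> \<gamma>}" and uv: "0 \<le> u" "0 \<le> v" "u + v = 1"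
    then show "u *\<^sub>R x + v *\<^sub>R y \<in> {y. \<alpha> * (cmod y)\<^sup>2 + Re (b * y) \<le> \<gamma>}"
      using order_trans[OF cv[OF uv] convex_bound_le[OF _ _ uv]] by simp
  qed
  show ?lt
  proof (rule convexI)
    fix x y and u v :: real
    assume "x \<in> {y. \<alpha> * (cmod y)\<^sup>2 + Re (b * y) < \<gamma>}"
      "y \<in> {y. \<alpha> * (cmod y)\<^sup>2 + Re (b * y) < \<gamma>}" and uv: "0 \<le> u" "0 \<le> v" "u + v = 1"
    then show "u *\<^sub>R x + v *\<^sub>R y \<in> {y. \<alpha> * (cmod y)\<^sup>2 + Re (b * y) < \<gamma>}"
      using order_le_less_trans[OF cv[OF uv] convex_bound_lt[OF _ _ uv]] by simp
  qed
qed

text \<open>Multiplying by \<open>cmod y\<close> and squaring gives a quadratic inequality with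
  leading coefficient \<open>1 - (cmod x)\<^sup>2 \<ge> 0\<close>. It also holds at
  \<open>y = 0\<close>, so that disjunct is absorbed.\<close>

lemma convex_inversion_unit_disc:
  assumes "cmod x \<le> 1"
  shows "convex {y. y = 0 \<or> x - 1 / y \<notin> cball 0 1}"
proof -
  have "{y. y = 0 \<or> x - 1 / y \<notin> cball 0 1} = {y. (1 - (cmod x)\<^sup>2) * (cmod y)\<^sup>2 + Re (2 * x * y) < 1}"
  proof (rule Collect_cong)
    fix y
    show "(y = 0 \<or> x - 1 / y \<notin> cball 0 1) = ((1 - (cmod x)\<^sup>2) * (cmod y)\<^sup>2 + Re (2 * x * y) < 1)"
    proof (cases "y = 0")
      case False
      have "x - 1 / y \<notin> cball 0 1 \<longleftrightarrow> cmod ((x * y - 1) / y) > 1"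
        using False by (simp add: diff_divide_distrib not_le)
      also have "\<dots> \<longleftrightarrow> cmod y < cmod (x * y - 1)"
        using False by (simp add: norm_divide field_simps)
      also have "\<dots> \<longleftrightarrow> (cmod y)\<^sup>2 < (cmod (x * y - 1))\<^sup>2"
        by (meson norm_ge_zero power_less_imp_less_base power_strict_mono pos2)
      also have "(cmod (x * y - 1))\<^sup>2 = (cmod x)\<^sup>2 * (cmod y)\<^sup>2 - Re (2 * x * y) + 1"
        unfolding cmod_power2 by (simp add: power2_eq_square algebra_simps)
      finally show ?thesis using False by (auto simp: algebra_simps)
    qed auto
  qed
  moreover have "0 \<le> 1 - (cmod x)\<^sup>2" using assms by (simp add: power_le_one)
  ultimately show ?thesis using convex_quadratic_sublevel(2)[of _ "2 * x" 1] by (simp only: )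
qed

lemma convex_inversion_half_plane:
  assumes "cmod x < cmod (x - c)"
  shows "convex {y. y = 0 \<or> x - 1 / y \<notin> {x. cmod x < cmod (x - c)}}"
proof -
  have "{y. y = 0 \<or> x - 1 / y \<notin> {x. cmod x < cmod (x - c)}}
     = {y. ((cmod (x - c))\<^sup>2 - (cmod x)\<^sup>2) * (cmod y)\<^sup>2 + Re (2 * c * y) \<le> 0}"
  proof (rule Collect_cong)
    fix y
    show "(y = 0 \<or> x - 1 / y \<notin> {x. cmod x < cmod (x - c)})
      = (((cmod (x - c))\<^sup>2 - (cmod x)\<^sup>2) * (cmod y)\<^sup>2 + Re (2 * c * y) \<le> 0)"
    proof (cases "y = 0")
      case False
      have "x - 1 / y \<notin> {x. cmod x < cmod (x - c)}
         \<longleftrightarrow> cmod (((x - c) * y - 1) / y) \<le> cmod ((x * y - 1) / y)"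
        proof -
        have "x - 1 / y - c = ((x - c) * y - 1) / y" "x - 1 / y = (x * y - 1) / y"
          using False by (simp_all add: field_simps)
        then show ?thesis by (simp add: not_less)
      qed
      also have "\<dots> \<longleftrightarrow> cmod ((x - c) * y - 1) \<le> cmod (x * y - 1)"
        using False by (simp add: norm_divide field_simps)
      also have "\<dots> \<longleftrightarrow> (cmod ((x - c) * y - 1))\<^sup>2 \<le> (cmod (x * y - 1))\<^sup>2"
        by (simp add: abs_le_square_iff[symmetric])
      also have "\<dots> \<longleftrightarrow> ((cmod (x - c))\<^sup>2 - (cmod x)\<^sup>2) * (cmod y)\<^sup>2 + Re (2 * c * y) \<le> 0"
      proof -
        have *: "(cmod (w * y - 1))\<^sup>2 = (cmod w)\<^sup>2 * (cmod y)\<^sup>2 - Re (2 * w * y) + 1" for w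
          unfolding cmod_power2 by (simp add: power2_eq_square algebra_simps)
        show ?thesis unfolding * by (simp add: algebra_simps)
      qed
      finally show ?thesis using False by auto
    qed auto
  qed
  moreover have "0 \<le> (cmod (x - c))\<^sup>2 - (cmod x)\<^sup>2" using assms by (simp add: power_mono)
  ultimately show ?thesis using convex_quadratic_sublevel(1)[of _ "2 * c" 0] by (simp only: )
qed

section \<open>Integration along a segment and critical points near its endpoint\<close>

text \<open>The path integral of \<open>f\<close> from 0 to \<open>c\<close>, written as a
  functional of \<open>f\<close> so that it can serve as \<open>L\<close> in
  \<open>grace_coincidence\<close>.\<close>

definition segment_integral :: "complex \<Rightarrow> complex poly \<Rightarrow> complex" where
  "segment_integral c f = c * integral {0..1} (\<lambda>t. poly f (of_real t * c))"

lemma segment_integral_add: "segment_integral c (f + g) = segment_integral c f + segment_integral c g"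
  unfolding segment_integral_def poly_add
  by (subst integral_add) (auto intro!: integrable_continuous_real continuous_intros simp: distrib_left)

lemma segment_integral_smult: "segment_integral c (smult b f) = b * segment_integral c f"
  unfolding segment_integral_def poly_smult integral_mult_right by (rule mult.left_commute)

lemma segment_integral_pderiv: "segment_integral c (pderiv f) = poly f c - poly f 0"
proof -
  have "((\<lambda>t. poly f (of_real t * c)) has_vector_derivative c * poly (pderiv f) (of_real t * c)) (at t within {0..1})"
    for t
  proof -
    have "((\<lambda>s. poly f (s * c)) has_field_derivative c * poly (pderiv f) (of_real t * c)) (at (of_real t))"
      by (subst mult.commute, rule DERIV_chain2[OF poly_DERIV]) (auto intro!: derivative_eq_intros)
    then show ?thesis
      by (intro has_vector_derivative_real_field)
  qed
  then have "((\<lambda>t. c * poly (pderiv f) (of_real t * c)) has_integral (poly f (of_real 1 * c) - poly f (of_real 0 * c))) {0..1}"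
    by (intro fundamental_theorem_of_calculus) auto
  then show ?thesis
    unfolding segment_integral_def by (simp add: integral_unique flip: integral_mult_right)
qed

lemma segment_integral_linear_power:
  "of_nat (Suc m) * b * segment_integral c ([:a, b:] ^ m) = (a + b * c) ^ Suc m - a ^ Suc m"
proof -
  have "pderiv ([:a, b:] ^ Suc m) = smult (of_nat (Suc m) * b) ([:a, b:] ^ m)"
    by (subst pderiv_power_Suc) (simp add: pderiv_pCons mult.commute)
  then have "of_nat (Suc m) * b * segment_integral c ([:a, b:] ^ m) = segment_integral c (pderiv ([:a, b:] ^ Suc m))"
    by (simp only: segment_integral_smult)
  also have "\<dots> = (a + b * c) ^ Suc m - a ^ Suc m"
    unfolding segment_integral_pderiv poly_power by (simp add: mult.commute)
  finally show ?thesis .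
qed

text \<open>Otherwise all \<open>\<zeta> j\<close> lie in the open half-plane nearer to 0 than to
  \<open>c\<close>. By coincidence it suffices to treat equal roots \<open>x\<close>, where a zero
  integral forces \<open>cmod (c - x) = cmod x\<close>, the excluded boundary line.\<close>

lemma root_near_endpoint:
  assumes "finite I" "c \<noteq> 0" "segment_integral c (\<Prod>j\<in>I. [:- \<zeta> j, 1:]) = 0"
  shows "\<exists>j\<in>I. cmod (\<zeta> j - c) \<le> cmod (\<zeta> j)"
proof (rule ccontr)
  assume "\<not> ?thesis"
  then have H: "\<zeta> j \<in> {x. cmod x < cmod (x - c)}" if "j \<in> I" for j
    using that by (auto simp: not_le)
  have lin: "[:0, 1:] - smult x 1 = [:- x, 1:]" for x :: complex
    by simp
  have "0 \<in> {x. cmod x < cmod (x - c)}" using assms(2) by simp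
  moreover have "segment_integral c (([:0, 1:] - smult x 1) ^ card I) \<noteq> 0" if "x \<in> {x. cmod x < cmod (x - c)}" for x
  proof
    assume "segment_integral c (([:0, 1:] - smult x 1) ^ card I) = 0"
    then have "(c - x) ^ Suc (card I) = (- x) ^ Suc (card I)"
      using segment_integral_linear_power[of "card I" 1 c "- x"] unfolding lin by (simp del: power_Suc)
    then have "cmod (c - x) = cmod (- x)"
      using power_eq_imp_eq_norm by blast
    then show False using that by (simp add: norm_minus_commute)
  qed
  ultimately have "segment_integral c (\<Prod>j\<in>I. [:0, 1:] - smult (\<zeta> j) 1) \<noteq> 0"
    using convex_inversion_half_plane assms(1) H
    by (intro grace_coincidence[where C = "{x. cmod x < cmod (x - c)}" and L = "segment_integral c"
          and A = "[:0, 1:]" and B = 1 and u = \<zeta> and I = I])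
      (blast | simp only: segment_integral_add segment_integral_smult)+
  then show False using assms(3) unfolding lin by simp
qed

section \<open>Lower bound for the increment on a small circle\<close>

text \<open>The Taylor coefficients of \<open>1 - (1 - v)\<^sup>\<alpha>\<close> are nonnegative for \<open>0 < \<alpha> \<le> 1\<close>, so its modulus is
  at most its value at \<open>\<bar>v\<bar>\<close>; here this is obtained by integrating the derivative along \<open>[0, v]\<close>.\<close>
lemma one_minus_powr_bound:
  assumes "cmod v < 1" "0 < \<alpha>" "\<alpha> \<le> 1"
  shows "cmod (1 - (1 - v) powr of_real \<alpha>) \<le> 1 - (1 - cmod v) powr \<alpha>"
proof -
  define f where "f = (\<lambda>t. (1 - of_real t * v) powr of_real \<alpha>)"
  define f' where "f' = (\<lambda>t. of_real \<alpha> * (1 - of_real t * v) powr (of_real \<alpha> - 1) * (- v))"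
  define g where "g = (\<lambda>t. - ((1 - t * cmod v) powr \<alpha>))"
  define g' where "g' = (\<lambda>t. \<alpha> * (1 - t * cmod v) powr (\<alpha> - 1) * cmod v)"
  have small: "t * cmod v < 1" if "t \<in> {0..1}" for t
    using that assms mult_left_le_one_le[of "cmod v" t] by auto
  have re: "0 < Re (1 - of_real t * v)" if "t \<in> {0..1}" for t
    using small[OF that] complex_Re_le_cmod[of "of_real t * v"] that by (simp add: norm_mult)
  have df: "(f has_vector_derivative f' t) (at t)" if "t \<in> {0..1}" for t
    unfolding f_def f'_def
    by (rule has_vector_derivative_real_field)
       (use re[OF that] in \<open>auto intro!: derivative_eq_intros simp: complex_nonpos_Reals_iff\<close>)
  have dg: "(g has_vector_derivative g' t) (at t)" if "t \<in> {0..1}" for t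
    unfolding g_def g'_def has_real_derivative_iff_has_vector_derivative[symmetric]
    using small[OF that] by (auto intro!: derivative_eq_intros simp: powr_diff divide_simps)
  have "cmod (f 1 - f 0) \<le> g 1 - g 0"
  proof (rule differentiable_bound_general)
    show "continuous_on {0..1} f"
      using df by (meson continuous_at_imp_continuous_on has_vector_derivative_continuous)
    show "continuous_on {0..1} g"
      using dg by (meson continuous_at_imp_continuous_on has_vector_derivative_continuous)
    fix t :: real
    assume t: "0 < t" "t < 1"
    have "1 - t * cmod v \<le> cmod (1 - of_real t * v)"
      using norm_triangle_ineq2[of 1 "of_real t * v"] t by (simp add: norm_mult)
    \<comment> \<open>Since \<open>\<alpha> - 1 \<le> 0\<close>, a lower bound on the base is an
      upper bound on the power.\<close>
    then have "cmod (1 - of_real t * v) powr (\<alpha> - 1) \<le> (1 - t * cmod v) powr (\<alpha> - 1)"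
      using small[of t] t assms by (intro powr_mono2') auto
    then have "\<alpha> * cmod (1 - of_real t * v) powr (\<alpha> - 1) * cmod v \<le> g' t"
      unfolding g'_def using assms by (intro mult_right_mono mult_left_mono) auto
    then show "cmod (f' t) \<le> g' t"
      unfolding f'_def using assms norm_powr_real_powr'[of "of_real (\<alpha> - 1)" "1 - of_real t * v"]
      by (simp add: norm_mult)
  qed (use df dg in auto)
  then show ?thesis by (simp add: f_def g_def norm_minus_commute)
qed

text \<open>In the sector the principal \<open>n\<close>-th root of \<open>w ^ n\<close> is
  \<open>w\<close>, so \<open>one_minus_powr_bound\<close> applies to \<open>v = 1 - w ^ n\<close>.
  If \<open>cmod (1 - w ^ n) \<ge> 1\<close>, the left side is at most 1 anyway.\<close>

lemma one_minus_power_sector_bound: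
  fixes w :: complex
  assumes n: "n > 0" and re: "Re w > 0" and arg: "\<bar>Im (Ln w)\<bar> \<le> pi / n" and small: "cmod (1 - w) \<le> 1"
  shows "1 - (1 - cmod (1 - w)) ^ n \<le> cmod (1 - w ^ n)"
proof (cases "cmod (1 - w ^ n) < 1")
  case False
  then show ?thesis using small zero_le_power[of "1 - cmod (1 - w)" n] by linarith
next
  case True
  have w0: "w \<noteq> 0" using re by auto
  have wn: "w ^ n = exp (of_nat n * Ln w)"
    using w0 by (simp add: exp_of_nat_mult)
  \<comment> \<open>A positive real part rules out the argument \<open>pi\<close> of
    \<open>w ^ n\<close>, which the closed sector alone would permit.\<close>
  have "0 < Re (w ^ n)" using True complex_Re_le_cmod[of "1 - w ^ n"] by simp
  then have "0 < cos (n * Im (Ln w))" unfolding wn by (simp add: Re_exp zero_less_mult_iff)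
  moreover have "\<bar>n * Im (Ln w)\<bar> \<le> pi"
    using arg n by (simp add: abs_mult field_simps)
  ultimately have "\<bar>n * Im (Ln w)\<bar> < pi"
    by (smt (verit) cos_minus cos_pi)
  then have "Ln (w ^ n) = of_nat n * Ln w"
    unfolding wn by (intro Ln_exp) (auto simp: abs_less_iff)
  then have "(w ^ n) powr of_real (1 / n) = w"
    using w0 n by (simp add: powr_def)
  then have le: "cmod (1 - w) \<le> 1 - (1 - cmod (1 - w ^ n)) powr (1 / n)"
    using one_minus_powr_bound[of "1 - w ^ n" "1 / n"] True n by simp
  then have "(1 - cmod (1 - w ^ n)) powr (1 / n) \<le> 1 - cmod (1 - w)" by simp
  then have "((1 - cmod (1 - w ^ n)) powr (1 / n)) ^ n \<le> (1 - cmod (1 - w)) ^ n"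
    by (intro power_mono) auto
  moreover have "((1 - cmod (1 - w ^ n)) powr (1 / n)) ^ n = 1 - cmod (1 - w ^ n)"
    using True n by (simp add: powr_power)
  ultimately show ?thesis by simp
qed

text \<open>\<open>\<bar>sin \<phi>\<bar>\<close> is the distance from 1 to the line through 0 and
  \<open>1 - s\<close>, hence at most \<open>cmod s\<close>.\<close>

lemma disc_in_sector:
  assumes n: "n \<ge> 2" and s: "cmod s < 1" "cmod s \<le> sin (pi / n)"
  shows "\<bar>Im (Ln (1 - s))\<bar> \<le> pi / real n"
proof -
  define \<phi> where "\<phi> = Im (Ln (1 - s))"
  have re: "0 < Re (1 - s)" using s complex_Re_le_cmod[of s] by simp
  then have w0: "1 - s \<noteq> 0" by (metis less_irrefl zero_complex.simps(1))
  have half: "\<bar>\<phi>\<bar> < pi / 2" unfolding \<phi>_def using re w0 Re_Ln_pos_lt by blast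
  have "1 - s = of_real (cmod (1 - s)) * cis \<phi>"
    using exp_eq_polar[of "Ln (1 - s)"] w0 by (simp add: \<phi>_def)
  then have "cis (- \<phi>) * (1 - s) = of_real (cmod (1 - s)) * (cis (- \<phi>) * cis \<phi>)"
    by (metis mult.left_commute)
  then have "cis (- \<phi>) * s = cis (- \<phi>) - of_real (cmod (1 - s))"
    by (simp add: cis_mult algebra_simps)
  then have "Im (cis (- \<phi>) * s) = - sin \<phi>" by simp
  then have "\<bar>sin \<phi>\<bar> \<le> cmod (cis (- \<phi>) * s)" by (metis abs_Im_le_cmod abs_minus_cancel)
  then have "\<bar>sin \<phi>\<bar> \<le> sin (pi / n)" using s by (simp add: norm_mult)
  then have "sin \<bar>\<phi>\<bar> \<le> sin (pi / n)" by (auto simp: abs_if split: if_splits)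
  \<comment> \<open>Here \<open>n \<ge> 2\<close> places \<open>pi / n\<close> where the sine is
    increasing.\<close>
  moreover have "pi / n \<le> pi / 2" using n by (intro divide_left_mono) auto
  ultimately show ?thesis
    unfolding \<phi>_def[symmetric] using half sin_mono_le_eq[of "\<bar>\<phi>\<bar>" "pi / n"] pi_ge_zero
    by (smt (verit) divide_nonneg_nonneg of_nat_0_le_iff)
qed

text \<open>As a function of \<open>x\<close>, the right side is concave and vanishes at 0, so it
  lies above its chord over \<open>[0, 1]\<close>. This later allows division by
  \<open>cmod x\<close>.\<close>

lemma power_convex_combination_bound:
  fixes x r :: real
  assumes "0 \<le> x" "x \<le> 1" "0 \<le> r" "r \<le> 1"
  shows "x * (1 - (1 - r) ^ n) \<le> 1 - (1 - x * r) ^ n"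
proof (induction n)
  case (Suc n)
  have xr: "x * r \<le> 1" using assms by (simp add: mult_le_one)
  have "(1 - x * r) ^ Suc n \<le> (1 - x * r) * (1 - x * (1 - (1 - r) ^ n))"
    using Suc xr by (simp add: mult_left_mono)
  also have "\<dots> = 1 - x * (1 - (1 - r) ^ Suc n) - x * r * (1 - (1 - r) ^ n) * (1 - x)"
    by (simp add: algebra_simps)
  also have "\<dots> \<le> 1 - x * (1 - (1 - r) ^ Suc n)"
    using assms by (simp add: power_le_one)
  finally show ?case by simp
qed simp

lemma segment_integral_growth:
  assumes "finite I" and u: "\<And>j. j \<in> I \<Longrightarrow> cmod (u j) \<le> 1" and n: "n = Suc (card I)" "n \<ge> 2"
    and r: "cmod z = r" "r < 1" "r \<le> sin (pi / n)"
  shows "1 - (1 - r) ^ n \<le> n * cmod (segment_integral z (\<Prod>j\<in>I. [:1, - u j:]))"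
proof -
  define v where "v = segment_integral z (\<Prod>j\<in>I. [:1, - u j:])"
  \<comment> \<open>Every product of factors \<open>[:1, - x:]\<close> has constant coefficient 1,
    so \<open>L\<close> vanishes on it exactly when its integral is \<open>v\<close>. Coincidence
    thus yields one \<open>x\<close> with the same integral.\<close>
  define L where "L = (\<lambda>f. segment_integral z f - v * coeff f 0)"
  have lin: "1 - smult x [:0, 1:] = [:1, - x:]" for x :: complex by (simp add: one_pCons)
  have "coeff (\<Prod>j\<in>I. [:1, - u j:]) 0 = 1"
    by (simp flip: poly_0_coeff_0 add: poly_prod)
  then have L0: "L (\<Prod>j\<in>I. 1 - smult (u j) [:0, 1:]) = 0"
    unfolding lin L_def v_def by simp
  have "\<exists>x\<in>cball 0 1. L ((1 - smult x [:0, 1:]) ^ card I) = 0"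
  proof (rule ccontr)
    assume "\<not> ?thesis"
    then have "L (\<Prod>j\<in>I. 1 - smult (u j) [:0, 1:]) \<noteq> 0"
      using assms(1) u convex_inversion_unit_disc
      by (intro grace_coincidence[where C = "cball 0 1" and L = L
            and A = 1 and B = "[:0, 1:]" and u = u and I = I])
         (auto simp: L_def segment_integral_add segment_integral_smult algebra_simps)
    then show False using L0 by auto
  qed
  then obtain x where x: "cmod x \<le> 1" and Lx: "L ([:1, - x:] ^ card I) = 0"
    unfolding lin by auto
  have "coeff ([:1, - x:] ^ card I) 0 = 1"
    by (simp flip: poly_0_coeff_0 add: poly_power)
  then have v: "segment_integral z ([:1, - x:] ^ card I) = v"
    using Lx unfolding L_def by simp
  have r0: "0 \<le> r" using r by auto
  show ?thesis
  \<comment> \<open>The closed form of the integral determines \<open>v\<close> only for nonzero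
    \<open>x\<close>; at \<open>x = 0\<close> the integral is \<open>z\<close> and Bernoulli's
    inequality suffices.\<close>
  proof (cases "x = 0")
    case True
    then have "v = z"
      using v by (simp add: segment_integral_def flip: one_pCons)
    then show ?thesis
      using Bernoulli_inequality[of "- r" n] r unfolding v_def[symmetric] by simp
  next
    case False
    have small: "cmod (x * z) = cmod x * r" using r by (simp add: norm_mult)
    have xr: "cmod x * r \<le> r" using x r0 by (simp add: mult_left_le_one_le)
    have re: "0 < Re (1 - x * z)"
      using complex_Re_le_cmod[of "x * z"] small xr r by simp
    have "of_nat n * (- x) * v = (1 - x * z) ^ n - 1"
      using segment_integral_linear_power[of "card I" "- x" z 1] v n(1) by simp
    then have "cmod (of_nat n * (- x) * v) = cmod (1 - (1 - x * z) ^ n)"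
      by (simp only: norm_minus_commute)
    then have "cmod x * (n * cmod v) = cmod (1 - (1 - x * z) ^ n)"
      by (simp add: norm_mult ac_simps)
    also have "\<dots> \<ge> 1 - (1 - cmod x * r) ^ n"
    proof -
      have "\<bar>Im (Ln (1 - x * z))\<bar> \<le> pi / n"
        using small xr r by (intro disc_in_sector n(2)) linarith+
      then show ?thesis
        using one_minus_power_sector_bound[of n "1 - x * z", OF _ re] small xr r n(2) by force
    qed
    also have "1 - (1 - cmod x * r) ^ n \<ge> cmod x * (1 - (1 - r) ^ n)"
      using x r r0 by (intro power_convex_combination_bound) auto
    finally show ?thesis using False unfolding v_def by simp
  qed
qed

section \<open>Covering a disc of values by the open mapping theorem\<close>

text \<open>Within \<open>ball 0 M\<close> the image is open, and also closed because the boundary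
  circle maps outside that ball; connectedness gives the whole ball. Compactness of the image of
  \<open>cball a r\<close> adds the case \<open>cmod w = M\<close>.\<close>

lemma poly_covers_disc:
  fixes f :: "complex poly"
  assumes r: "r > 0" and "poly f a = 0" "poly (pderiv f) a \<noteq> 0"
    and bd: "\<And>z. cmod (z - a) = r \<Longrightarrow> M \<le> cmod (poly f z)" and w: "cmod w \<le> M"
  shows "\<exists>z\<in>cball a r. poly f z = w"
proof (cases "w = 0")
  case True
  then show ?thesis using assms by (intro bexI[of _ a]) auto
next
  case False
  then have M: "M > 0" using w by (smt (verit) zero_less_norm_iff)
  let ?S = "poly f ` ball a r \<inter> ball 0 M"
  have "\<not> poly f constant_on ball a r"
  proof
    assume "poly f constant_on ball a r"
    then obtain c where c: "\<And>z. z \<in> ball a r \<Longrightarrow> poly f z = c"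
      unfolding constant_on_def by blast
    have "(poly f has_field_derivative 0) (at a)"
      by (rule has_field_derivative_transform_within_open[OF DERIV_const[of c], of "ball a r"])
         (use r c in auto)
    then show False using assms(3) poly_DERIV DERIV_unique by blast
  qed
  then have "open (poly f ` ball a r)"
    by (intro open_mapping_thm[of "poly f" "ball a r"]) (auto intro!: holomorphic_intros)
  then have "openin (top_of_set (ball 0 M)) ?S"
    by (simp add: openin_open_Int Int_commute)
  moreover have comp: "compact (poly f ` cball a r)"
    by (intro compact_continuous_image continuous_intros) auto
  then have "closedin (top_of_set (ball 0 M)) (poly f ` cball a r \<inter> ball 0 M)"
    by (simp add: closedin_closed_Int compact_imp_closed Int_commute)
  moreover have eq: "poly f ` cball a r \<inter> ball 0 M = ?S"
  proof -
    have "z \<in> ball a r" if "z \<in> cball a r" "cmod (poly f z) < M" for z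
      using that bd[of z] by (force simp: dist_norm norm_minus_commute)
    then show ?thesis by (auto simp: less_imp_le)
  qed
  moreover have "0 \<in> ?S" using M r assms(2) by (auto intro!: image_eqI[of _ _ a])
  ultimately have "?S = ball 0 M"
    using connected_clopen[of "ball (0::complex) M"] unfolding eq by blast
  then have "ball 0 M \<subseteq> poly f ` cball a r" unfolding eq[symmetric] by blast
  then have "closure (ball 0 M) \<subseteq> poly f ` cball a r"
    using comp by (intro closure_minimal compact_imp_closed)
  moreover have "w \<in> closure (ball 0 M)" using M w by simp
  ultimately show ?thesis by auto
qed

section \<open>Locating the critical point\<close>

theorem theorem1:
  fixes n :: nat and a :: real and z \<zeta> :: "nat \<Rightarrow> complex"
    and p :: "complex poly" and lam :: real
  assumes "n \<ge> 2"
    and "0 < a" and "a < 1"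
    and "p = [:- complex_of_real a, 1:] * (\<Prod>k = 1..n-1. [:- z k, 1:])"
    and "\<And>k. k \<in> {1..n-1} \<Longrightarrow> cmod (z k) \<le> 1"
    and "pderiv p = smult (of_nat n) (\<Prod>j = 1..n-1. [:- \<zeta> j, 1:])"
    and "1 - root n (1 - cmod (poly p 0)) \<le> lam"
    and "lam \<le> sin (pi / real n)"
    and "lam < a"
    and "(MIN j\<in>{1..n-1}. cmod (complex_of_real a - \<zeta> j)) \<ge> 1"
  shows "\<exists>\<zeta>0. poly (pderiv p) \<zeta>0 = 0 \<and>
           Re \<zeta>0 \<ge> (a - lam * (lam + 2) / a) / 2"
proof -
  define I where "I = {1..n-1}"
  have I: "finite I" "I \<noteq> {}" "n = Suc (card I)" using assms(1) by (auto simp: I_def)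
  note p = assms(4)[folded I_def] and dp = assms(6)[folded I_def]
  have z: "cmod (z k) \<le> 1" if "k \<in> I" for k using assms(5) that by (simp add: I_def)
  have far: "1 \<le> cmod (of_real a - \<zeta> j)" if "j \<in> I" for j
    using assms(10) Min_ge_iff[of "(\<lambda>j. cmod (of_real a - \<zeta> j)) ` I" 1] I that
    unfolding I_def[symmetric] by auto

  have crit_le: "cmod x \<le> 1" if "poly (pderiv p) x = 0" for x
  proof (rule gauss_lucas_disc)
    let ?Z = "add_mset (of_real a) (image_mset z (mset_set I))"
    show "poly (pderiv (\<Prod>r\<in>#?Z. [:- r, 1:])) x = 0"
      using that unfolding p by (simp add: prod_unfold_prod_mset image_mset.compositionality o_def del: mult_pCons_left)
    show "cmod r \<le> 1" if "r \<in># ?Z" for r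
      using that z I(1) assms(2,3) by auto
  qed simp

  have "cmod (poly p 0) = a * (\<Prod>k\<in>I. cmod (z k))"
    unfolding p using assms(2) by (simp add: poly_prod norm_mult flip: prod_norm)
  also have "\<dots> \<le> 1"
    using assms(2,3) z by (intro mult_le_one prod_le_1 prod_nonneg) auto
  finally have p0: "cmod (poly p 0) \<le> 1" .
  then have "root n (1 - cmod (poly p 0)) \<le> 1" using assms(1) by simp
  then have lam0: "0 \<le> lam" using assms(7) by linarith
  \<comment> \<open>Monotonicity of the power needs \<open>0 \<le> 1 - lam\<close>, which follows
    from \<open>lam < a < 1\<close>.\<close>
  have "(1 - lam) ^ n \<le> root n (1 - cmod (poly p 0)) ^ n"
    using assms(3,7,9) by (intro power_mono) auto
  then have p0_le: "cmod (poly p 0) \<le> 1 - (1 - lam) ^ n"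
    using p0 assms(1) by simp

  \<comment> \<open>Translation moves \<open>a\<close> to 0, where \<open>segment_integral\<close>
    starts.\<close>
  define Q where "Q = pcompose p [:of_real a, 1:]"
  have Q: "poly Q x = poly p (of_real a + x)" for x
    by (simp add: Q_def poly_pcompose)
  define u where "u j = 1 / (\<zeta> j - of_real a)" for j
  \<comment> \<open>This is the derivative of \<open>p\<close> at \<open>a\<close>; its modulus is
    at least \<open>n\<close> because all critical points are at distance at least 1 from
    \<open>a\<close>.\<close>
  define b where "b = of_nat n * (\<Prod>j\<in>I. of_real a - \<zeta> j)"
  have "(\<Prod>j\<in>I. 1) \<le> (\<Prod>j\<in>I. cmod (of_real a - \<zeta> j))"
    using far by (intro prod_mono) auto
  then have b: "real n \<le> cmod b"
    unfolding b_def norm_mult prod_norm[symmetric] using mult_left_mono[of 1 _ "real n"] by simp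
  have "[:of_real a - \<zeta> j, 1:] = smult (of_real a - \<zeta> j) [:1, - u j:]" if "j \<in> I" for j
    using far[OF that] by (auto simp: u_def divide_simps)
  then have "(\<Prod>j\<in>I. [:of_real a - \<zeta> j, 1:]) = (\<Prod>j\<in>I. smult (of_real a - \<zeta> j) [:1, - u j:])"
    by (rule prod.cong[OF refl])
  also have "\<dots> = smult (\<Prod>j\<in>I. of_real a - \<zeta> j) (\<Prod>j\<in>I. [:1, - u j:])"
    by (rule prod_smult)
  finally have dQ: "pderiv Q = smult b (\<Prod>j\<in>I. [:1, - u j:])"
    unfolding Q_def pderiv_pcompose dp b_def
    by (simp add: pcompose_smult pcompose_prod pcompose_pCons pderiv_pCons)
  have Qa: "poly Q 0 = 0" unfolding Q p by simp

  have "\<exists>w\<in>cball 0 lam. poly Q w = poly p 0"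
  \<comment> \<open>The covering lemma needs a positive radius; \<open>lam = 0\<close> forces
    \<open>poly p 0 = 0\<close>, and then \<open>w = 0\<close> works.\<close>
  proof (cases "lam = 0")
    case True
    then show ?thesis using p0_le Qa assms(1) by simp
  next
    case False
    show ?thesis
    proof (rule poly_covers_disc[OF _ Qa _ _ p0_le])
      show "0 < lam" using lam0 False by simp
      show "poly (pderiv Q) 0 \<noteq> 0"
        unfolding dQ using b assms(1) by (auto simp: poly_prod)
      fix w :: complex
      assume "cmod (w - 0) = lam"
      then have "1 - (1 - lam) ^ n \<le> n * cmod (segment_integral w (\<Prod>j\<in>I. [:1, - u j:]))"
        using far assms I by (intro segment_integral_growth) (auto simp: u_def norm_divide norm_minus_commute divide_simps)
      also have "\<dots> \<le> cmod b * cmod (segment_integral w (\<Prod>j\<in>I. [:1, - u j:]))"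
        using b by (rule mult_right_mono) simp
      also have "\<dots> = cmod (segment_integral w (pderiv Q))"
        unfolding dQ segment_integral_smult norm_mult ..
      also have "\<dots> = cmod (poly Q w)"
        unfolding segment_integral_pderiv Qa by simp
      finally show "1 - (1 - lam) ^ n \<le> cmod (poly Q w)" .
    qed
  qed
  then obtain w where w: "cmod w \<le> lam" "poly p (of_real a + w) = poly p 0"
    unfolding Q by auto
  define c where "c = of_real a + w"
  have "c \<noteq> 0"
  proof
    assume "c = 0"
    then have "w = - of_real a" unfolding c_def by (simp add: add_eq_0_iff)
    then show False using w(1) assms(2,9) by simp
  qed
  have "segment_integral c (pderiv p) = 0"
    unfolding segment_integral_pderiv using w(2) by (simp add: c_def)
  then have "segment_integral c (\<Prod>j\<in>I. [:- \<zeta> j, 1:]) = 0"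
    unfolding dp segment_integral_smult using assms(1) by simp
  then obtain j where j: "j \<in> I" "cmod (\<zeta> j - c) \<le> cmod (\<zeta> j)"
    using root_near_endpoint[OF I(1) \<open>c \<noteq> 0\<close>] by blast
  have crit: "poly (pderiv p) (\<zeta> j) = 0"
    unfolding dp using j(1) I(1) by (auto simp: poly_prod)
  have "cmod (\<zeta> j - of_real a) \<le> cmod (\<zeta> j) + lam"
    using norm_triangle_ineq[of "\<zeta> j - c" w] j(2) w(1) by (simp add: c_def)
  then have "(cmod (\<zeta> j - of_real a))\<^sup>2 \<le> (cmod (\<zeta> j) + lam)\<^sup>2"
    by (intro power_mono) auto
  also have "\<dots> = (cmod (\<zeta> j))\<^sup>2 + 2 * lam * cmod (\<zeta> j) + lam\<^sup>2"
    by (simp add: power2_sum)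
  also have "\<dots> \<le> (cmod (\<zeta> j))\<^sup>2 + 2 * lam * 1 + lam\<^sup>2"
    using crit_le[OF crit] lam0 by (intro add_mono mult_left_mono) auto
  \<comment> \<open>The squares of \<open>cmod (\<zeta> j)\<close> cancel, leaving
    \<open>a\<^sup>2 - 2 * a * Re (\<zeta> j)\<close> on the left.\<close>
  finally have "a\<^sup>2 - lam * (lam + 2) \<le> 2 * a * Re (\<zeta> j)"
    unfolding cmod_power2 by (simp add: power2_eq_square algebra_simps)
  then have "(a - lam * (lam + 2) / a) / 2 \<le> Re (\<zeta> j)"
    using assms(2) by (simp add: field_simps power2_eq_square)
  then show ?thesis using crit by blast
qed

end
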